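(* Suppose that $m \geq 6$. Then every rational function $\phi \in \mathbb{C}(x)$ of degree at least $2$ with two distinct $m$-branch abundant points $\alpha_1, \alpha_2$ is trivial with respect to $\{\alpha_1, \alpha_2\}$.
   Context: For non-constant $\psi \in \mathbb{C}(x)$, $e_\psi(z)$ is the ramification index of $\psi$ at $z\in\mathbb{P}^1(\mathbb{C})$, and $\phi^n$ is the $n$-th iterate. A point $\alpha$ is $m$-branch abundant for $\phi$ if the number of $z \in \phi^{-n}(\alpha)$ with $m \nmid e_{\phi^n}(z)$ is bounded as $n \to \infty$. For $\phi$ of degree $\geq 2$ and distinct $\alpha_1,\alpha_2 \in \mathbb{P}^1(\mathbb{C})$, $\phi$ is trivial with respect to $\{\alpha_1,\alpha_2\}$ if $m \mid e_\phi(z)$ for all $z \in \phi^{-1}(\{\alpha_1,\alpha_2\}) \setminus \{\alpha_1,\alpha_2\}$. *)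

theory Defs
  imports
    "HOL-Computational_Algebra.Computational_Algebra"
    "HOL-Computational_Algebra.Field_as_Ring"
begin

type_synonym ratfun = "complex poly fract"

datatype proj_line = Fin complex | Infty

text \<open>Numerator and denominator in lowest terms, with monic denominator.\<close>

definition rf_num :: "ratfun \<Rightarrow> complex poly" where
  "rf_num f = fst (quot_of_fract f)"

definition rf_den :: "ratfun \<Rightarrow> complex poly" where
  "rf_den f = snd (quot_of_fract f)"

definition rf_const :: "complex \<Rightarrow> ratfun" where
  "rf_const a = to_fract [:a:]"

definition rf_X :: ratfun where
  "rf_X = to_fract [:0, 1:]"

definition rf_degree :: "ratfun \<Rightarrow> nat" where
  "rf_degree f = max (degree (rf_num f)) (degree (rf_den f))"

text \<open>For coprime \<open>p\<close> and \<open>q\<close>, at most one of \<open>p z\<close> and \<open>q z\<close> vanishes. At infinity the value is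
  decided by the degrees; if \<open>degree p < degree q\<close> the coefficient of \<open>p\<close> below is \<open>0\<close>.\<close>

definition rf_eval :: "ratfun \<Rightarrow> proj_line \<Rightarrow> proj_line" where
  "rf_eval f w = (let p = rf_num f; q = rf_den f in
     case w of
       Fin z \<Rightarrow> if poly q z = 0 then Infty else Fin (poly p z / poly q z)
     | Infty \<Rightarrow> if degree p > degree q then Infty
                else Fin (coeff p (degree q) / lead_coeff q))"

text \<open>The composite of \<open>f\<close> with \<open>g\<close> is \<open>f(g(x))\<close>, obtained by substituting \<open>g\<close> for the variable
  in numerator and denominator of \<open>f\<close>. The denominator cannot become zero if \<open>g\<close> is
  non-constant, since \<open>g\<close> is then transcendental over the constants.\<close>

definition rf_comp :: "ratfun \<Rightarrow> ratfun \<Rightarrow> ratfun" where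
  "rf_comp f g = poly (map_poly rf_const (rf_num f)) g / poly (map_poly rf_const (rf_den f)) g"

definition rf_iter :: "ratfun \<Rightarrow> nat \<Rightarrow> ratfun" where
  "rf_iter f n = (rf_comp f ^^ n) rf_X"

text \<open>Order of vanishing of \<open>f\<close> at a point (negative at a pole); meaningful for \<open>f \<noteq> 0\<close> only.
  A local parameter at infinity is \<open>1/x\<close>.\<close>

definition rf_ord :: "proj_line \<Rightarrow> ratfun \<Rightarrow> int" where
  "rf_ord w f = (case w of
       Fin z \<Rightarrow> int (order z (rf_num f)) - int (order z (rf_den f))
     | Infty \<Rightarrow> int (degree (rf_den f)) - int (degree (rf_num f)))"

text \<open>The ramification index at \<open>w\<close> is the order of vanishing at \<open>w\<close> of the pullback of a local
  parameter at the image point: \<open>x - a\<close> at a finite point \<open>a\<close>, and \<open>1/x\<close> at infinity.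
  It is meaningful for non-constant \<open>f\<close>, and then it is positive.\<close>

definition ram_index :: "ratfun \<Rightarrow> proj_line \<Rightarrow> nat" where
  "ram_index f w = nat (case rf_eval f w of
       Fin a \<Rightarrow> rf_ord w (f - rf_const a)
     | Infty \<Rightarrow> rf_ord w (inverse f))"

text \<open>Finiteness is stated explicitly because \<open>card\<close> is \<open>0\<close> on infinite sets.\<close>

definition branch_abundant :: "nat \<Rightarrow> ratfun \<Rightarrow> proj_line \<Rightarrow> bool" where
  "branch_abundant m f \<alpha> \<longleftrightarrow>
     (\<exists>B. \<forall>n. let S = {z. rf_eval (rf_iter f n) z = \<alpha> \<and> \<not> m dvd ram_index (rf_iter f n) z}
              in finite S \<and> card S \<le> B)"

definition trivial_wrt :: "nat \<Rightarrow> ratfun \<Rightarrow> proj_line set \<Rightarrow> bool" where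
  "trivial_wrt m f A \<longleftrightarrow> (\<forall>z. rf_eval f z \<in> A \<and> z \<notin> A \<longrightarrow> m dvd ram_index f z)"

end

(* Suppose z is a point of the fibre of phi over alpha_1 (say) that differs from alpha_1 and alpha_2
   and whose ramification index is not divisible by m. Let g be the n-th iterate of phi, of degree D.
   Up to boundedly many exceptions, the points of the fibres of g over alpha_1 and alpha_2 have index
   at least m >= 6. By multiplicativity of ramification indices the points w of the fibre over z have
   index e_g(w) >= 2, again up to boundedly many exceptions, because m divides e_phi(z) * e_g(w).
   So the three fibres together have at most D/6 + D/6 + D/2 + O(1) points, whereas by
   Riemann-Hurwitz they have more than D. As D is unbounded, this is a contradiction.

   It suffices to count finite points of the fibres. They are the roots of the polynomials p - a q
   and q, where p/q = g, and the needed case of Riemann-Hurwitz is the Wronskian argument for the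
   Mason-Stothers theorem. *)

theory Submission
  imports Defs
begin

section \<open>Coprimality and root counting over an algebraically closed field\<close>

lemma coprime_if_no_common_root:
  fixes p q :: "'a :: {alg_closed_field, field_gcd} poly"
  assumes "\<And>z. poly p z = 0 \<Longrightarrow> poly q z \<noteq> 0" and "p \<noteq> 0 \<or> q \<noteq> 0"
  shows "coprime p q"
proof -
  have "degree (gcd p q) = 0"
  proof (rule ccontr)
    assume "degree (gcd p q) \<noteq> 0"
    then obtain z where "poly (gcd p q) z = 0"
      using alg_closed_imp_poly_has_root[of "gcd p q"] by auto
    then have "[:-z, 1:] dvd gcd p q"
      by (simp add: poly_eq_0_iff_dvd)
    then have "poly p z = 0" "poly q z = 0"
      by (auto simp: poly_eq_0_iff_dvd)
    then show False
      using assms by blast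
  qed
  then have "is_unit (gcd p q)"
    using assms by (subst is_unit_iff_degree) auto
  then show ?thesis
    using is_unit_gcd by blast
qed

text \<open>The induction splits off the full power of one root at a time; a non-zero polynomial
  without roots is constant by algebraic closedness.\<close>

lemma sum_order_eq_degree:
  fixes p :: "'a :: alg_closed_field poly"
  assumes "p \<noteq> 0"
  shows "(\<Sum>z | poly p z = 0. order z p) = degree p"
  using assms
proof (induction p rule: poly_root_order_induct)
  case (no_roots p)
  then show ?case
    using alg_closed_imp_poly_has_root[of p] by fastforce
next
  case (root p x n)
  then have "p \<noteq> 0" by auto
  have ord: "order z ([:-x, 1:] ^ n * p) = (if z = x then n else order z p)" for z
  proof -
    have "order z ([:-x, 1:] ^ n) = 0" if "z \<noteq> x"
      using that by (intro order_0I) (simp add: poly_power)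
    then show ?thesis
      using root \<open>p \<noteq> 0\<close> by (auto simp: order_mult order_power_n_n order_0I)
  qed
  have roots: "{z. poly ([:-x, 1:] ^ n * p) z = 0} = insert x {z. poly p z = 0}"
    using root by (auto simp: poly_power)
  have "(\<Sum>z | poly p z = 0. if z = x then n else order z p) = (\<Sum>z | poly p z = 0. order z p)"
    using root by (intro sum.cong) auto
  then show ?case
    using root \<open>p \<noteq> 0\<close> poly_roots_finite[of p] unfolding ord roots
    by (subst sum.insert) (auto simp: degree_mult_eq degree_power_eq)
qed simp

section \<open>Representations in lowest terms\<close>

lemma coprime_rf: "coprime (rf_num f) (rf_den f)"
  by (simp add: rf_num_def rf_den_def coprime_quot_of_fract)

lemma rf_den_nonzero [simp]: "rf_den f \<noteq> 0"
  by (simp add: rf_den_def)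

lemma rf_conv_num_den: "f = to_fract (rf_num f) / to_fract (rf_den f)"
  by (simp add: rf_num_def rf_den_def flip: Fract_conv_to_fract)

lemma rf_no_common_root: "poly (rf_num f) z = 0 \<Longrightarrow> poly (rf_den f) z \<noteq> 0"
  using coprime_poly_0[OF coprime_rf] by blast

text \<open>After cross-multiplication, coprimality on both sides makes the two denominators divide
  each other, so they differ by a unit, that is, a non-zero constant. Orders and degrees can
  therefore be computed from any quotient in lowest terms.\<close>

lemma rf_num_den_unique:
  assumes "f = to_fract p / to_fract q" and "coprime p q" and "q \<noteq> 0"
  obtains c where "c \<noteq> 0" "rf_num f = smult c p" "rf_den f = smult c q"
proof -
  have "to_fract (rf_num f) / to_fract (rf_den f) = to_fract p / to_fract q"
    using assms(1) rf_conv_num_den by metis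
  then have "to_fract (rf_num f * q) = to_fract (p * rf_den f)"
    using assms(3) by (simp add: field_simps)
  then have eq: "rf_num f * q = p * rf_den f"
    by (simp only: to_fract_eq_iff)
  then have "q dvd rf_den f"
    using assms(2) by (metis coprime_commute coprime_dvd_mult_right_iff dvd_triv_right)
  then obtain u where u: "rf_den f = q * u" ..
  moreover have "rf_den f dvd q"
    using eq coprime_rf by (metis coprime_commute coprime_dvd_mult_right_iff dvd_triv_right)
  then obtain v where v: "q = rf_den f * v" ..
  ultimately have "u * v = 1"
    using assms(3) by (metis mult.assoc mult.right_neutral mult_left_cancel)
  then have "is_unit u" and "u \<noteq> 0"
    by (metis dvd_triv_left, auto)
  then have "degree u = 0"
    by (simp add: is_unit_iff_degree)
  then obtain c where "u = [:c:]"
    using degree_eq_zeroE by blast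
  with \<open>u \<noteq> 0\<close> have c: "u = [:c:]" "c \<noteq> 0"
    by auto
  have "rf_num f * q = (u * p) * q"
    using eq u by (simp add: ac_simps)
  then have "rf_num f = u * p"
    using assms(3) by simp
  then show ?thesis
    using c u that[of c] by simp
qed

section \<open>Fibre polynomials and ramification indices\<close>

text \<open>The roots of the fibre polynomial, with multiplicity, are the finite points of the fibre
  with their ramification indices; its defect \<open>rf_degree f - degree\<close> is the ramification index
  at infinity.\<close>

definition fibre_poly :: "ratfun \<Rightarrow> proj_line \<Rightarrow> complex poly" where
  "fibre_poly f \<alpha> = (case \<alpha> of Fin a \<Rightarrow> rf_num f - smult a (rf_den f) | Infty \<Rightarrow> rf_den f)"

text \<open>The multiplicity of z as a zero of \<open>fibre_poly f \<alpha>\<close> read as a binary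
  form of degree \<open>rf_degree f\<close>: missing degree counts as a zero at infinity. In
  contrast to \<open>ram_index\<close>, the target \<alpha> is an argument, so that the value can be
  0 off the fibre.\<close>

definition fibre_mult :: "ratfun \<Rightarrow> proj_line \<Rightarrow> proj_line \<Rightarrow> nat" where
  "fibre_mult f \<alpha> z = (case z of
     Fin w \<Rightarrow> order w (fibre_poly f \<alpha>)
   | Infty \<Rightarrow> rf_degree f - degree (fibre_poly f \<alpha>))"

text \<open>If p = a q with p and q coprime, then q divides both and is a unit, so p/q is
  constant.\<close>

lemma fibre_poly_nonzero:
  assumes "rf_degree f \<ge> 1"
  shows "fibre_poly f \<alpha> \<noteq> 0"
proof
  assume 0: "fibre_poly f \<alpha> = 0"
  then obtain a where a: "\<alpha> = Fin a" "rf_num f = smult a (rf_den f)"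
    by (auto simp: fibre_poly_def split: proj_line.splits)
  then have "is_unit (rf_den f)"
    using coprime_rf[of f] by (metis coprime_common_divisor dvd_refl dvd_smult)
  then have "degree (rf_den f) = 0"
    by (simp add: is_unit_iff_degree)
  then show False
    using assms a by (auto simp: rf_degree_def split: if_splits)
qed

lemma rf_num_nonzero:
  assumes "rf_degree f \<ge> 1"
  shows "rf_num f \<noteq> 0"
  using fibre_poly_nonzero[OF assms, of "Fin 0"] by (simp add: fibre_poly_def)

lemma degree_fibre_poly_le: "degree (fibre_poly f \<alpha>) \<le> rf_degree f"
  by (auto simp: fibre_poly_def rf_degree_def split: proj_line.splits
      intro!: degree_diff_le order_trans[OF degree_smult_le])

lemma rf_eval_Fin_iff: "rf_eval f (Fin w) = \<alpha> \<longleftrightarrow> poly (fibre_poly f \<alpha>) w = 0"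
  using rf_no_common_root[of f w]
  by (cases \<alpha>) (auto simp: rf_eval_def fibre_poly_def Let_def field_simps)

text \<open>Cancellation of the top coefficients lowers the degree only if that degree is positive,
  because \<open>degree 0 = 0\<close>; hence the second conjunct.\<close>

lemma degree_fibre_poly_Fin_less_iff:
  assumes *: "degree (rf_num f) \<le> degree (rf_den f)"
  shows "degree (fibre_poly f (Fin a)) < degree (rf_den f) \<longleftrightarrow>
    coeff (rf_num f) (degree (rf_den f)) = a * lead_coeff (rf_den f) \<and> degree (rf_den f) > 0"
proof -
  let ?d = "degree (rf_den f)" and ?P = "fibre_poly f (Fin a)"
  have le: "degree ?P \<le> ?d"
    using degree_fibre_poly_le[of f "Fin a"] * by (simp add: rf_degree_def)
  have "degree ?P < ?d \<longleftrightarrow> coeff ?P ?d = 0 \<and> ?d > 0"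
    using le by (metis bot_nat_0.not_eq_extremum coeff_eq_0 degree_0 leading_coeff_0_iff
        less_nat_zero_code nat_less_le)
  then show ?thesis
    by (simp add: fibre_poly_def)
qed

text \<open>If f has a pole at infinity, subtracting a multiple of the denominator cannot lower the
  degree of the numerator, and only the denominator itself is too short. Otherwise the degree drops
  exactly when the coefficients that determine the value at infinity cancel.\<close>

lemma degree_fibre_poly_less_iff:
  assumes "rf_degree f \<ge> 1"
  shows "degree (fibre_poly f \<alpha>) < rf_degree f \<longleftrightarrow> rf_eval f Infty = \<alpha>"
proof (cases "degree (rf_num f) > degree (rf_den f)")
  case True
  have "degree (fibre_poly f (Fin a)) = degree (rf_num f)" for a
  proof -
    have "degree (smult (- a) (rf_den f)) < degree (rf_num f)"
      using True by (meson degree_smult_le le_less_trans)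
    from degree_add_eq_left[OF this] show ?thesis
      by (simp add: fibre_poly_def)
  qed
  moreover have "rf_degree f = degree (rf_num f)"
    using True by (simp add: rf_degree_def)
  moreover have "rf_eval f Infty = Infty"
    using True by (simp add: rf_eval_def)
  ultimately show ?thesis
    using True by (cases \<alpha>) (simp_all add: fibre_poly_def[of f Infty])
next
  case False
  then have deg: "rf_degree f = degree (rf_den f)"
    by (simp add: rf_degree_def)
  have ev: "rf_eval f Infty = Fin (coeff (rf_num f) (rf_degree f) / lead_coeff (rf_den f))"
    using False by (simp add: rf_eval_def deg Let_def)
  show ?thesis
  proof (cases \<alpha>)
    case (Fin a)
    then show ?thesis
      using degree_fibre_poly_Fin_less_iff[of f a] False assms leading_coeff_0_iff[of "rf_den f"]
      unfolding ev by (auto simp: deg field_simps)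
  qed (simp add: ev deg fibre_poly_def)
qed

lemma rf_eval_iff_fibre_mult:
  assumes "rf_degree f \<ge> 1"
  shows "rf_eval f z = \<alpha> \<longleftrightarrow> fibre_mult f \<alpha> z > 0"
  using degree_fibre_poly_less_iff[OF assms] fibre_poly_nonzero[OF assms]
  by (cases z) (auto simp: fibre_mult_def rf_eval_Fin_iff order_gt_0_iff)

text \<open>Both f - a = (p - a q)/q and 1/f = q/p are in lowest terms, with the fibre polynomial as
  numerator. At a finite point of the fibre the denominator does not vanish, and if infinity is in
  the fibre, the denominator has degree \<open>rf_degree f\<close>; so the order depends on the
  fibre polynomial alone.\<close>

lemma ram_index_eq_fibre_mult:
  assumes deg: "rf_degree f \<ge> 1" and "rf_eval f z = \<alpha>"
  shows "ram_index f z = fibre_mult f \<alpha> z"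
proof (cases \<alpha>)
  case (Fin a)
  let ?P = "fibre_poly f (Fin a)" and ?q = "rf_den f"
  have P: "?P = rf_num f - smult a ?q"
    by (simp add: fibre_poly_def)
  have "f - rf_const a = to_fract (rf_num f) / to_fract ?q - to_fract [:a:]"
    by (simp add: rf_const_def flip: rf_conv_num_den)
  also have "\<dots> = to_fract (rf_num f - [:a:] * ?q) / to_fract ?q"
    by (simp only: to_fract_diff to_fract_mult) (simp add: field_simps)
  also have "rf_num f - [:a:] * ?q = ?P"
    by (simp add: P)
  finally have rep: "f - rf_const a = to_fract ?P / to_fract ?q" .
  have "coprime ?P ?q"
    using rf_no_common_root[of f] by (intro coprime_if_no_common_root) (auto simp: P)
  then obtain c where c: "c \<noteq> 0" "rf_num (f - rf_const a) = smult c ?P"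
    "rf_den (f - rf_const a) = smult c ?q"
    using rf_num_den_unique[OF rep] by auto
  have "rf_ord z (f - rf_const a) = int (fibre_mult f \<alpha> z)"
  proof (cases z)
    case (Fin w)
    have "poly ?q w \<noteq> 0"
      using assms(2) rf_no_common_root[of f w] \<open>\<alpha> = Fin a\<close> Fin by (auto simp: rf_eval_Fin_iff P)
    then show ?thesis
      using c Fin \<open>\<alpha> = Fin a\<close> by (simp add: rf_ord_def order_smult fibre_mult_def order_0I)
  next
    case Infty
    then have "\<not> degree (rf_num f) > degree ?q"
      using assms(2) \<open>\<alpha> = Fin a\<close> by (auto simp: rf_eval_def split: if_splits)
    then have "rf_degree f = degree ?q"
      by (simp add: rf_degree_def)
    then show ?thesis
      using c Infty \<open>\<alpha> = Fin a\<close> degree_fibre_poly_le[of f \<alpha>]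
      by (simp add: rf_ord_def fibre_mult_def)
  qed
  then show ?thesis
    using assms(2) Fin by (simp add: ram_index_def)
next
  case Infty
  have "inverse f = to_fract (rf_den f) / to_fract (rf_num f)"
    by (metis rf_conv_num_den inverse_divide)
  moreover have "coprime (rf_den f) (rf_num f)"
    using coprime_rf coprime_commute by blast
  ultimately obtain c where c: "c \<noteq> 0" "rf_num (inverse f) = smult c (rf_den f)"
    "rf_den (inverse f) = smult c (rf_num f)"
    using rf_num_den_unique[of "inverse f"] rf_num_nonzero[OF deg] by metis
  have "rf_ord z (inverse f) = int (fibre_mult f \<alpha> z)"
  proof (cases z)
    case (Fin w)
    then have "poly (rf_num f) w \<noteq> 0"
      using assms(2) rf_no_common_root[of f w] Infty
      by (auto simp: rf_eval_Fin_iff fibre_poly_def)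
    then show ?thesis
      using c Fin Infty by (simp add: rf_ord_def order_smult fibre_mult_def fibre_poly_def order_0I)
  next
    case z: Infty
    then have "degree (rf_num f) > degree (rf_den f)"
      using assms(2) \<open>\<alpha> = Infty\<close> by (auto simp: rf_eval_def Let_def split: if_splits)
    then show ?thesis
      using c z \<open>\<alpha> = Infty\<close> by (simp add: rf_ord_def fibre_mult_def fibre_poly_def rf_degree_def)
  qed
  then show ?thesis
    using assms(2) Infty by (simp add: ram_index_def)
qed


section \<open>Composition and ramification\<close>

text \<open>For \<open>degree p \<le> d\<close> this is s^d * p(r/s) with denominators cleared: the
  binary form of degree d belonging to p, at the pair (r, s).\<close>

definition homogenise :: "nat \<Rightarrow> complex poly \<Rightarrow> complex poly \<Rightarrow> complex poly \<Rightarrow> complex poly" where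
  "homogenise d p r s = (\<Sum>i\<le>d. smult (coeff p i) (r ^ i * s ^ (d - i)))"

text \<open>The same form at a pair of numbers, seen as homogeneous coordinates of a/b, so that b =
  0 stands for infinity.\<close>

definition binary_form :: "nat \<Rightarrow> complex poly \<Rightarrow> complex \<Rightarrow> complex \<Rightarrow> complex" where
  "binary_form d p a b = (\<Sum>i\<le>d. coeff p i * (a ^ i * b ^ (d - i)))"

lemma poly_eq_sum_atMost:
  fixes p :: "'a :: comm_semiring_1 poly"
  assumes "degree p \<le> d"
  shows "poly p x = (\<Sum>i\<le>d. coeff p i * x ^ i)"
  unfolding poly_altdef using assms by (intro sum.mono_neutral_left) (auto simp: coeff_eq_0)

lemma to_fract_power: "to_fract (x ^ n) = to_fract x ^ n"
  by (induction n) simp_all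

lemma rf_const_0 [simp]: "rf_const 0 = 0"
  by (simp add: rf_const_def)

lemma rf_const_add: "rf_const (a + b) = rf_const a + rf_const b"
  by (simp add: rf_const_def flip: to_fract_add)

lemma rf_const_mult: "rf_const (a * b) = rf_const a * rf_const b"
  by (simp add: rf_const_def flip: to_fract_mult)

lemma to_fract_smult: "to_fract (smult c p) = rf_const c * to_fract p"
  by (simp add: rf_const_def flip: to_fract_mult)

lemma poly_rf_const_add:
  "poly (map_poly rf_const (p + q)) x = poly (map_poly rf_const p) x + poly (map_poly rf_const q) x"
proof -
  have "map_poly rf_const (p + q) = map_poly rf_const p + map_poly rf_const q"
    by (rule poly_eqI) (simp add: coeff_map_poly rf_const_add)
  then show ?thesis by simp
qed

lemma poly_rf_const_smult:
  "poly (map_poly rf_const (smult c p)) x = rf_const c * poly (map_poly rf_const p) x"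
proof -
  have "map_poly rf_const (smult c p) = smult (rf_const c) (map_poly rf_const p)"
    by (rule poly_eqI) (simp add: coeff_map_poly rf_const_mult)
  then show ?thesis by simp
qed

lemma poly_rf_const_mult:
  "poly (map_poly rf_const (p * q)) x = poly (map_poly rf_const p) x * poly (map_poly rf_const q) x"
proof (induction p)
  case (pCons a p)
  then show ?case
    by (simp add: poly_rf_const_add poly_rf_const_smult map_poly_pCons algebra_simps)
qed simp

lemma to_fract_homogenise:
  assumes "s \<noteq> 0" and "degree p \<le> d"
  shows "to_fract (homogenise d p r s) =
    to_fract s ^ d * poly (map_poly rf_const p) (to_fract r / to_fract s)"
proof -
  have "degree (map_poly rf_const p) \<le> d"
    using assms(2) map_poly_degree_leq le_trans by blast
  then have "poly (map_poly rf_const p) (to_fract r / to_fract s) =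
      (\<Sum>i\<le>d. rf_const (coeff p i) * (to_fract r / to_fract s) ^ i)"
    by (simp add: poly_eq_sum_atMost coeff_map_poly)
  moreover have "to_fract s ^ d * (to_fract r / to_fract s) ^ i = to_fract r ^ i * to_fract s ^ (d - i)"
    if "i \<le> d" for i
    using assms(1) that by (simp add: field_simps flip: power_add)
  ultimately show ?thesis
    by (simp add: homogenise_def to_fract_smult to_fract_power sum_distrib_left mult.left_commute)
qed

text \<open>In the fraction field, homogenising is substitution of r/s followed by multiplication
  with a power of s, and substitution is multiplicative.\<close>

lemma homogenise_mult:
  assumes "s \<noteq> 0" and "degree p \<le> d" and "degree q \<le> e"
  shows "homogenise (d + e) (p * q) r s = homogenise d p r s * homogenise e q r s"
proof -
  have "degree (p * q) \<le> d + e"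
    using assms(2,3) degree_mult_le[of p q] by linarith
  then have "to_fract (homogenise (d + e) (p * q) r s) =
      to_fract (homogenise d p r s * homogenise e q r s)"
    using assms by (simp add: to_fract_homogenise poly_rf_const_mult power_add)
  then show ?thesis
    by (simp only: to_fract_eq_iff)
qed

text \<open>A root y of order n thus turns into the n-th power of r - y s, which is the fibre
  polynomial of r/s over y.\<close>

lemma homogenise_linear_power:
  assumes "s \<noteq> 0"
  shows "homogenise n ([:- y, 1:] ^ n) r s = (r - smult y s) ^ n"
proof (induction n)
  case (Suc n)
  have "degree ([:- y, 1:] ^ n) \<le> n"
    by (simp add: degree_power_eq)
  then have "homogenise (1 + n) ([:- y, 1:] * [:- y, 1:] ^ n) r s =
      homogenise 1 [:- y, 1:] r s * homogenise n ([:- y, 1:] ^ n) r s"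
    using assms by (intro homogenise_mult) auto
  moreover have "homogenise 1 [:- y, 1:] r s = r - smult y s"
    by (simp add: homogenise_def)
  ultimately show ?case
    using Suc by simp
qed (simp add: homogenise_def)

lemma homogenise_1: "homogenise k 1 r s = s ^ k"
  by (simp add: homogenise_def sum.atMost_shift)

lemma poly_homogenise: "poly (homogenise d p r s) w = binary_form d p (poly r w) (poly s w)"
  by (simp add: homogenise_def binary_form_def poly_sum)

lemma binary_form_nonzero_snd:
  assumes "b \<noteq> 0" and "degree p \<le> d"
  shows "binary_form d p a b = b ^ d * poly p (a / b)"
proof -
  have "b ^ d * (a / b) ^ i = a ^ i * b ^ (d - i)" if "i \<le> d" for i
    using assms(1) that by (simp add: field_simps flip: power_add)
  then show ?thesis
    using assms(2) by (simp add: binary_form_def poly_eq_sum_atMost sum_distrib_left mult.left_commute)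
qed

lemma binary_form_0_snd: "binary_form d p a 0 = coeff p d * a ^ d"
proof -
  have "binary_form d p a 0 = (\<Sum>i\<in>{d}. coeff p i * (a ^ i * 0 ^ (d - i)))"
    unfolding binary_form_def by (intro sum.mono_neutral_right) auto
  then show ?thesis by simp
qed

text \<open>For b \<noteq> 0 a common zero would make a/b a common root of numerator and
  denominator; for b = 0 the forms reduce to the coefficients in degree \<open>rf_degree f\<close>,
  one of which is non-zero. So the two forms define a map on the whole projective line.\<close>

lemma binary_forms_no_common_zero:
  assumes "a \<noteq> 0 \<or> b \<noteq> 0"
  shows "binary_form (rf_degree f) (rf_num f) a b \<noteq> 0 \<or> binary_form (rf_degree f) (rf_den f) a b \<noteq> 0"
proof (cases "b = 0")
  case False
  have "degree (rf_num f) \<le> rf_degree f" "degree (rf_den f) \<le> rf_degree f"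
    by (auto simp: rf_degree_def)
  with False show ?thesis
    using rf_no_common_root[of f "a / b"] by (simp add: binary_form_nonzero_snd)
next
  case True
  have "coeff (rf_num f) (rf_degree f) \<noteq> 0 \<or> coeff (rf_den f) (rf_degree f) \<noteq> 0"
  proof (cases "degree (rf_num f) \<le> degree (rf_den f)")
    case True
    then show ?thesis by (simp add: rf_degree_def)
  next
    case False
    then have "rf_degree f = degree (rf_num f)" "rf_num f \<noteq> 0"
      by (auto simp: rf_degree_def)
    then show ?thesis by simp
  qed
  with True assms show ?thesis
    by (auto simp: binary_form_0_snd)
qed

lemma coeff_mult_degree_bounds:
  assumes "degree p \<le> m" and "degree q \<le> n"
  shows "coeff (p * q) (m + n) = coeff p m * coeff q n"
proof -
  have "coeff (p * q) (m + n) = (\<Sum>i\<in>{m}. coeff p i * coeff q (m + n - i))"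
    unfolding coeff_mult
  proof (intro sum.mono_neutral_right ballI)
    fix i assume "i \<in> {..m + n} - {m}"
    then have "degree p < i \<or> degree q < m + n - i"
      using assms by auto
    then show "coeff p i * coeff q (m + n - i) = 0"
      by (auto simp: coeff_eq_0)
  qed auto
  then show ?thesis by simp
qed

lemma degree_power_bound: "degree p \<le> m \<Longrightarrow> degree (p ^ n) \<le> n * m"
  by (metis degree_power_le mult.commute mult_le_mono2 order_trans)

lemma coeff_power_degree_bound:
  assumes "degree p \<le> m"
  shows "coeff (p ^ n) (n * m) = coeff p m ^ n"
proof (induction n)
  case (Suc n)
  then show ?case
    using coeff_mult_degree_bounds[OF assms degree_power_bound[OF assms, of n]] by simp
qed simp

text \<open>This serves the degree of a composite: if e is the degree of r/s, then the coefficients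
  of r and s at e are homogeneous coordinates of its value at infinity.\<close>

lemma coeff_homogenise:
  assumes "degree r \<le> e" and "degree s \<le> e"
  shows "coeff (homogenise d p r s) (d * e) = binary_form d p (coeff r e) (coeff s e)"
proof -
  have "coeff (r ^ i * s ^ (d - i)) (d * e) = coeff r e ^ i * coeff s e ^ (d - i)" if "i \<le> d" for i
  proof -
    have "d * e = i * e + (d - i) * e"
      using that by (simp flip: add_mult_distrib)
    then show ?thesis
      using assms by (simp add: coeff_mult_degree_bounds coeff_power_degree_bound degree_power_bound)
  qed
  then show ?thesis
    by (simp add: homogenise_def binary_form_def coeff_sum)
qed

section \<open>Composition: degrees, values and multiplicativity of ramification\<close>

text \<open>The composite is the quotient of the two homogenised polynomials. As the forms of f have
  no common zero, these polynomials have no common root, and their coefficients at the product of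
  the degrees do not both vanish.\<close>

lemma rf_comp_degree_num_den:
  assumes f: "rf_degree f \<ge> 1" and g: "rf_degree g \<ge> 1"
  shows "rf_degree (rf_comp f g) \<ge> rf_degree f * rf_degree g"
    and "\<exists>c. c \<noteq> 0 \<and>
      rf_num (rf_comp f g) = smult c (homogenise (rf_degree f) (rf_num f) (rf_num g) (rf_den g)) \<and>
      rf_den (rf_comp f g) = smult c (homogenise (rf_degree f) (rf_den f) (rf_num g) (rf_den g))"
proof -
  define d e r s where defs: "d = rf_degree f" "e = rf_degree g" "r = rf_num g" "s = rf_den g"
  define p q where pq: "p = homogenise d (rf_num f) r s" "q = homogenise d (rf_den f) r s"
  have s: "s \<noteq> 0" and de: "d * e \<ge> 1"
    using f g by (auto simp: defs)
  \<comment> \<open>The pair (1, 0) represents infinity; the forms of g take these coefficients as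
    values there.\<close>
  have "coeff r e \<noteq> 0 \<or> coeff s e \<noteq> 0"
    using binary_forms_no_common_zero[of 1 0 g] by (simp add: binary_form_0_snd defs)
  moreover have "degree r \<le> e" "degree s \<le> e"
    by (auto simp: defs rf_degree_def)
  ultimately have "coeff p (d * e) \<noteq> 0 \<or> coeff q (d * e) \<noteq> 0"
    using binary_forms_no_common_zero[of "coeff r e" "coeff s e" f]
    by (simp add: pq coeff_homogenise defs(1))
  then have deg: "d * e \<le> max (degree p) (degree q)" and nz: "p \<noteq> 0 \<or> q \<noteq> 0"
    by (auto simp: le_max_iff_disj intro: le_degree)
  have no_root: "poly q w \<noteq> 0" if "poly p w = 0" for w
    using binary_forms_no_common_zero[of "poly r w" "poly s w" f] rf_no_common_root[of g w] that
    by (auto simp: pq poly_homogenise defs)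
  have cop: "coprime p q"
    using no_root nz by (rule coprime_if_no_common_root)
  have q: "q \<noteq> 0"
  proof
    assume "q = 0"
    \<comment> \<open>The degree bound must then come from p, and any root of p is shared with the
      zero polynomial q.\<close>
    then have "degree p > 0"
      using deg de by (metis One_nat_def Suc_le_lessD degree_0 le_trans max_0R)
    then obtain w where "poly p w = 0"
      using alg_closed_imp_poly_has_root by blast
    then show False
      using no_root \<open>q = 0\<close> by auto
  qed
  have "degree (rf_num f) \<le> d" "degree (rf_den f) \<le> d"
    by (auto simp: defs rf_degree_def)
  then have "to_fract p = to_fract s ^ d * poly (map_poly rf_const (rf_num f)) g"
    and "to_fract q = to_fract s ^ d * poly (map_poly rf_const (rf_den f)) g"
    using s by (simp_all add: pq to_fract_homogenise flip: rf_conv_num_den[of g, folded defs])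
  then have "rf_comp f g = to_fract p / to_fract q"
    using s by (simp add: rf_comp_def)
  then obtain c where c: "c \<noteq> 0" "rf_num (rf_comp f g) = smult c p" "rf_den (rf_comp f g) = smult c q"
    using rf_num_den_unique cop q by blast
  then show "\<exists>c. c \<noteq> 0 \<and>
      rf_num (rf_comp f g) = smult c (homogenise (rf_degree f) (rf_num f) (rf_num g) (rf_den g)) \<and>
      rf_den (rf_comp f g) = smult c (homogenise (rf_degree f) (rf_den f) (rf_num g) (rf_den g))"
    unfolding pq defs by blast
  show "rf_degree (rf_comp f g) \<ge> rf_degree f * rf_degree g"
    using deg c unfolding rf_degree_def[of "rf_comp f g"] by (simp add: defs)
qed

lemma fibre_poly_rf_comp:
  assumes "rf_degree f \<ge> 1" and "rf_degree g \<ge> 1"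
  shows "\<exists>c. c \<noteq> 0 \<and> fibre_poly (rf_comp f g) \<alpha> =
    smult c (homogenise (rf_degree f) (fibre_poly f \<alpha>) (rf_num g) (rf_den g))"
proof -
  have "homogenise d (p - smult a q) r s = homogenise d p r s - smult a (homogenise d q r s)"
    for d p q r s and a :: complex
    by (rule poly_eqI)
      (simp add: homogenise_def coeff_sum sum_distrib_left sum_subtractf[symmetric] algebra_simps)
  then show ?thesis
    using rf_comp_degree_num_den(2)[OF assms]
    by (cases \<alpha>) (auto simp: fibre_poly_def smult_diff_right mult.commute)
qed

lemma order_power:
  fixes p :: "'a :: idom poly"
  assumes "p \<noteq> 0"
  shows "order x (p ^ n) = n * order x p"
  using assms by (induction n) (simp_all add: order_mult)

text \<open>The homogenised P is G to the power \<open>fibre_mult f \<alpha> z\<close> times a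
  cofactor that does not vanish at w. For finite z the power comes from the corresponding linear
  factor of P, for z at infinity from the degree defect of P.\<close>

lemma order_fibre_poly_rf_comp:
  assumes f: "rf_degree f \<ge> 1" and g: "rf_degree g \<ge> 1" and z: "rf_eval g (Fin w) = z"
  shows "order w (fibre_poly (rf_comp f g) \<alpha>) = fibre_mult f \<alpha> z * order w (fibre_poly g z)"
proof -
  define d P r s G where defs: "d = rf_degree f" "P = fibre_poly f \<alpha>" "r = rf_num g" "s = rf_den g"
    "G = fibre_poly g z"
  have nz: "s \<noteq> 0" "P \<noteq> 0" "G \<noteq> 0" and degP: "degree P \<le> d"
    using fibre_poly_nonzero f g degree_fibre_poly_le by (auto simp: defs)
  have "\<exists>R. homogenise d P r s = G ^ fibre_mult f \<alpha> z * R \<and> poly R w \<noteq> 0"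
  proof (cases z)
    case (Fin y)
    have G: "G = r - smult y s"
      using Fin by (simp add: defs fibre_poly_def)
    have mult: "fibre_mult f \<alpha> z = order y P"
      using Fin by (simp add: fibre_mult_def defs)
    obtain Q where Q: "P = [:- y, 1:] ^ order y P * Q" "\<not> [:- y, 1:] dvd Q"
      using order_decomp[OF nz(2)] by blast
    then have "Q \<noteq> 0" and "poly Q y \<noteq> 0"
      by (auto simp: poly_eq_0_iff_dvd)
    have "degree P = order y P + degree Q"
      using \<open>Q \<noteq> 0\<close> by (subst Q(1)) (simp add: degree_mult_eq degree_power_eq)
    then have le: "order y P \<le> d" and degQ: "degree Q \<le> d - order y P"
      using degP by auto
    have "homogenise (order y P + (d - order y P)) ([:- y, 1:] ^ order y P * Q) r s =
        G ^ order y P * homogenise (d - order y P) Q r s"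
      using nz(1) degQ unfolding G
      by (subst homogenise_mult) (simp_all add: homogenise_linear_power degree_power_eq)
    then have eq: "homogenise d P r s = G ^ order y P * homogenise (d - order y P) Q r s"
      using le Q(1) by simp
    have "poly G w = 0"
      using z by (simp add: rf_eval_Fin_iff defs)
    then have "poly r w = y * poly s w" and "poly s w \<noteq> 0"
      using rf_no_common_root[of g w] by (auto simp: G defs)
    \<comment> \<open>The value is a power of s(w) times Q(y), and both are non-zero.\<close>
    then have "poly (homogenise (d - order y P) Q r s) w \<noteq> 0"
      using \<open>poly Q y \<noteq> 0\<close> degQ by (simp add: poly_homogenise binary_form_nonzero_snd)
    with eq mult show ?thesis by auto
  next
    case Infty
    have G: "G = s"
      using Infty by (simp add: defs fibre_poly_def)
    \<comment> \<open>The factor 1, homogenised in the missing degree, contributes the power of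
      s.\<close>
    have "homogenise ((d - degree P) + degree P) (1 * P) r s = s ^ (d - degree P) * homogenise (degree P) P r s"
      using nz(1) by (subst homogenise_mult) (simp_all add: homogenise_1)
    then have eq: "homogenise d P r s = G ^ fibre_mult f \<alpha> z * homogenise (degree P) P r s"
      using degP Infty G by (simp add: fibre_mult_def defs)
    have "poly s w = 0"
      using z G by (simp add: rf_eval_Fin_iff defs)
    then have "poly r w \<noteq> 0"
      using rf_no_common_root[of g w] by (auto simp: defs)
    \<comment> \<open>Where s vanishes only the leading coefficient survives; it is non-zero because
      P is homogenised in its exact degree.\<close>
    then have "poly (homogenise (degree P) P r s) w \<noteq> 0"
      using nz(2) \<open>poly s w = 0\<close> by (simp add: poly_homogenise binary_form_0_snd)
    with eq show ?thesis by auto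
  qed
  then obtain R where R: "homogenise d P r s = G ^ fibre_mult f \<alpha> z * R" "poly R w \<noteq> 0"
    by blast
  then have "R \<noteq> 0" by auto
  obtain c where "c \<noteq> 0" "fibre_poly (rf_comp f g) \<alpha> = smult c (homogenise d P r s)"
    using fibre_poly_rf_comp[OF f g] unfolding defs by blast
  then show ?thesis
    using R \<open>R \<noteq> 0\<close> nz(3) unfolding defs(5)[symmetric]
    by (simp add: order_smult order_mult order_power order_0I)
qed

text \<open>Values are read off from orders: a product of two positive multiplicities is positive,
  so w is a root of the fibre polynomial of the composite.\<close>

lemma rf_eval_rf_comp_Fin:
  assumes "rf_degree f \<ge> 1" and "rf_degree g \<ge> 1"
  shows "rf_eval (rf_comp f g) (Fin w) = rf_eval f (rf_eval g (Fin w))"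
proof -
  define z \<alpha> where defs: "z = rf_eval g (Fin w)" "\<alpha> = rf_eval f z"
  have "fibre_mult f \<alpha> z > 0" and "order w (fibre_poly g z) > 0"
    using rf_eval_iff_fibre_mult[OF assms(1), of z \<alpha>] rf_eval_iff_fibre_mult[OF assms(2), of "Fin w" z]
    by (simp_all add: defs fibre_mult_def)
  then have "order w (fibre_poly (rf_comp f g) \<alpha>) \<noteq> 0"
    using order_fibre_poly_rf_comp[OF assms, of w z \<alpha>] by (simp add: defs)
  then show ?thesis
    using order_root by (simp add: rf_eval_Fin_iff defs) blast
qed

lemma ram_index_Fin:
  assumes "rf_degree f \<ge> 1" and "poly (fibre_poly f \<alpha>) w = 0"
  shows "ram_index f (Fin w) = order w (fibre_poly f \<alpha>)"
  using ram_index_eq_fibre_mult[of f "Fin w" \<alpha>] assms by (simp add: rf_eval_Fin_iff fibre_mult_def)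

lemma ram_index_rf_comp_Fin:
  assumes f: "rf_degree f \<ge> 1" and g: "rf_degree g \<ge> 1"
  shows "ram_index (rf_comp f g) (Fin w) = ram_index f (rf_eval g (Fin w)) * ram_index g (Fin w)"
proof -
  define z \<alpha> where defs: "z = rf_eval g (Fin w)" "\<alpha> = rf_eval f z"
  have "rf_degree (rf_comp f g) \<ge> 1"
    using rf_comp_degree_num_den(1)[OF f g] mult_le_mono[OF f g] by linarith
  moreover have "rf_eval (rf_comp f g) (Fin w) = \<alpha>"
    using rf_eval_rf_comp_Fin[OF f g] defs by simp
  ultimately have "ram_index (rf_comp f g) (Fin w) = order w (fibre_poly (rf_comp f g) \<alpha>)"
    by (intro ram_index_Fin) (simp_all flip: rf_eval_Fin_iff)
  also have "\<dots> = fibre_mult f \<alpha> z * order w (fibre_poly g z)"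
    using order_fibre_poly_rf_comp[OF f g] defs by blast
  also have "\<dots> = ram_index f z * ram_index g (Fin w)"
    using ram_index_eq_fibre_mult[OF f, of z \<alpha>] ram_index_eq_fibre_mult[OF g, of "Fin w" z]
    by (simp add: defs fibre_mult_def)
  finally show ?thesis
    by (simp add: defs)
qed

lemma degree_rf_iter:
  assumes "rf_degree f \<ge> 2"
  shows "rf_degree (rf_iter f n) \<ge> 2 ^ n"
proof (induction n)
  case 0
  show ?case
    by (simp add: rf_iter_def rf_X_def rf_degree_def rf_num_def rf_den_def)
next
  case (Suc n)
  have "(1::nat) \<le> 2 ^ n" by simp
  with Suc have "rf_degree (rf_iter f n) \<ge> 1" by linarith
  then have "rf_degree f * rf_degree (rf_iter f n) \<le> rf_degree (rf_iter f (Suc n))"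
    using rf_comp_degree_num_den(1)[of f "rf_iter f n"] assms by (simp add: rf_iter_def)
  moreover have "2 * 2 ^ n \<le> rf_degree f * rf_degree (rf_iter f n)"
    using assms Suc by (rule mult_le_mono)
  ultimately show ?case by simp
qed

section \<open>Counting points in fibres\<close>

lemma degree_wronskian_less:
  fixes p q :: "'a :: field_char_0 poly"
  assumes "degree p \<le> d" and "d \<ge> 1"
  shows "degree (pderiv p * q - p * pderiv q) < d + degree q"
proof -
  have "degree (pderiv p * q) < d + degree q"
    using assms degree_mult_le[of "pderiv p" q] by (simp add: degree_pderiv)
  moreover have "degree (p * pderiv q) < d + degree q"
  \<comment> \<open>For constant q, truncated subtraction gives the derivative no smaller degree
    than q, but the derivative is zero.\<close>
  proof (cases "degree q = 0")
    case True
    then have "pderiv q = 0"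
      by (simp add: pderiv_eq_0_iff)
    then show ?thesis
      using assms by simp
  next
    case False
    then show ?thesis
      using assms degree_mult_le[of p "pderiv q"] by (simp add: degree_pderiv)
  qed
  ultimately show ?thesis
    by (rule degree_diff_less)
qed

text \<open>Every fibre polynomial has the same Wronskian with the denominator (up to a constant), and
  a fibre point of multiplicity \<open>e\<close> is a root of it of order at least \<open>e - 1\<close>.\<close>

lemma fibres_card_ge:
  assumes f: "rf_degree f \<ge> 1" and "finite T"
  shows "card T * rf_degree f < 2 * rf_degree f + (\<Sum>\<alpha>\<in>T. card {w. poly (fibre_poly f \<alpha>) w = 0})"
proof -
  define p q D W where defs: "p = rf_num f" "q = rf_den f" "D = rf_degree f" "W = pderiv p * q - p * pderiv q"
  define R where "R = (\<lambda>\<alpha>. {w. poly (fibre_poly f \<alpha>) w = 0})"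
  define L where "L = rf_eval f Infty"
  \<comment> \<open>Replacing p by p - a q leaves the Wronskian unchanged, since the terms a q q'
    cancel.\<close>
  have W_fibre: "\<exists>b. W = (case \<alpha> of
      Fin a \<Rightarrow> pderiv (fibre_poly f \<alpha>) * q - fibre_poly f \<alpha> * pderiv q
    | Infty \<Rightarrow> pderiv p * fibre_poly f \<alpha> - p * pderiv (fibre_poly f \<alpha>))" for \<alpha>
    by (cases \<alpha>) (simp_all add: defs fibre_poly_def pderiv_diff pderiv_smult algebra_simps)
  \<comment> \<open>If W = 0, coprimality makes p and q divide their own derivatives, which have
    smaller degree unless they vanish. In characteristic 0 both are then constant.\<close>
  have W: "W \<noteq> 0"
  proof
    assume "W = 0"
    then have eq: "pderiv p * q = p * pderiv q"
      by (simp add: defs)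
    then have "q dvd pderiv q" "p dvd pderiv p"
      using coprime_rf[of f, folded defs]
      by (metis coprime_commute coprime_dvd_mult_right_iff dvd_triv_right dvd_triv_left mult.commute)+
    then have "pderiv q = 0" "pderiv p = 0"
      by (metis One_nat_def degree_pderiv diff_less dvd_imp_degree_le gr0I less_one linorder_not_le
          pderiv_eq_0_iff)+
    then show False
      using f by (auto simp: pderiv_eq_0_iff rf_degree_def defs)
  qed
  have order_le: "order w (fibre_poly f \<alpha>) \<le> Suc (order w W)" if "w \<in> R \<alpha>" for w \<alpha>
  proof -
    define P k where P_k_def: "P = fibre_poly f \<alpha>" "k = order w P - 1"
    have "P \<noteq> 0"
      using fibre_poly_nonzero[OF f] by (simp add: P_k_def)
    moreover have "poly P w = 0"
      using that by (simp add: R_def P_k_def)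
    ultimately have ord: "order w P = Suc (order w (pderiv P))"
      by (rule order_pderiv)
    then have "[:- w, 1:] ^ k dvd P" "[:- w, 1:] ^ k dvd pderiv P"
      by (simp_all add: P_k_def order_divides)
    then have "[:- w, 1:] ^ k dvd W"
      using W_fibre[of \<alpha>] unfolding P_k_def(1)
      by (cases \<alpha>) (auto intro!: dvd_diff intro: dvd_mult dvd_mult2)
    then show ?thesis
      using W by (simp add: order_divides P_k_def)
  qed
  \<comment> \<open>Computing W from the fibre over L, the only one whose polynomial can have degree
    below D, gives the bound that accounts for ramification at infinity. For finite L the degree
    lemma is applied to -W.\<close>
  have degW: "degree W + 1 \<le> D + degree (fibre_poly f L)"
  proof (cases L)
    case (Fin a)
    have "degree q \<le> D" "D \<ge> 1"
      using f by (auto simp: defs rf_degree_def)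
    from degree_wronskian_less[OF this, of "fibre_poly f L"] show ?thesis
      using W_fibre[of L] Fin degree_minus[of W] by (simp add: mult.commute)
  next
    case Infty
    have "degree p \<le> D" "D \<ge> 1"
      using f by (auto simp: defs rf_degree_def)
    from degree_wronskian_less[OF this, of "fibre_poly f L"] show ?thesis
      using W_fibre[of L] Infty by simp
  qed
  have fin: "finite (R \<alpha>)" for \<alpha>
    using fibre_poly_nonzero[OF f] by (simp add: R_def poly_roots_finite)
  have "(\<Sum>\<alpha>\<in>T. degree (fibre_poly f \<alpha>)) = (\<Sum>\<alpha>\<in>T. \<Sum>w\<in>R \<alpha>. order w (fibre_poly f \<alpha>))"
    using fibre_poly_nonzero[OF f] by (simp add: R_def sum_order_eq_degree)
  also have "\<dots> \<le> (\<Sum>\<alpha>\<in>T. \<Sum>w\<in>R \<alpha>. Suc (order w W))"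
    by (intro sum_mono order_le)
  also have "\<dots> = (\<Sum>\<alpha>\<in>T. card (R \<alpha>)) + (\<Sum>\<alpha>\<in>T. \<Sum>w\<in>R \<alpha>. order w W)"
    by (simp add: sum.distrib sum_Suc)
  \<comment> \<open>Fibres over different points are disjoint, so each root of W is counted at most
    once.\<close>
  also have "(\<Sum>\<alpha>\<in>T. \<Sum>w\<in>R \<alpha>. order w W) = (\<Sum>w\<in>(\<Union>\<alpha>\<in>T. R \<alpha>). order w W)"
    using assms(2) fin by (intro sum.UNION_disjoint[symmetric]) (auto simp: R_def simp flip: rf_eval_Fin_iff)
  also have "\<dots> \<le> (\<Sum>w | poly W w = 0. order w W)"
  proof -
    have "(\<Sum>w\<in>(\<Union>\<alpha>\<in>T. R \<alpha>). order w W) = (\<Sum>w\<in>(\<Union>\<alpha>\<in>T. R \<alpha>) \<inter> {w. poly W w = 0}. order w W)"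
      using assms(2) fin by (intro sum.mono_neutral_right) (auto simp: order_root)
    also have "\<dots> \<le> (\<Sum>w | poly W w = 0. order w W)"
      using poly_roots_finite[OF W] by (intro sum_mono2) auto
    finally show ?thesis .
  qed
  also have "\<dots> = degree W"
    using W by (rule sum_order_eq_degree)
  finally have upper: "(\<Sum>\<alpha>\<in>T. degree (fibre_poly f \<alpha>)) \<le> (\<Sum>\<alpha>\<in>T. card (R \<alpha>)) + degree W"
    by simp
  have "card T * D = (\<Sum>\<alpha>\<in>T. D)" by simp
  \<comment> \<open>Only the fibre over L has a degree defect, whether or not L belongs to
    T.\<close>
  also have "\<dots> \<le> (\<Sum>\<alpha>\<in>T. degree (fibre_poly f \<alpha>) + (if \<alpha> = L then D - degree (fibre_poly f L) else 0))"
    using degree_fibre_poly_less_iff[OF f] by (intro sum_mono) (auto simp: L_def defs(3) simp flip: not_less)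
  also have "\<dots> \<le> (\<Sum>\<alpha>\<in>T. degree (fibre_poly f \<alpha>)) + (D - degree (fibre_poly f L))"
    using assms(2) by (simp add: sum.distrib sum.delta)
  \<comment> \<open>The degree of the fibre polynomial over L enters with opposite signs and
    cancels, which leaves 2 D - 1.\<close>
  finally show ?thesis
    using upper degW degree_fibre_poly_le[of f L] unfolding R_def defs(3) by linarith
qed

lemma sum_order_fibre_le:
  assumes "rf_degree f \<ge> 1"
  shows "(\<Sum>w | poly (fibre_poly f \<alpha>) w = 0. order w (fibre_poly f \<alpha>)) \<le> rf_degree f"
  by (rule order_trans[OF sum_order_le_degree[OF fibre_poly_nonzero[OF assms]] degree_fibre_poly_le])

text \<open>Each finite fibre point outside S uses up at least k of a total multiplicity of at most
  \<open>rf_degree f\<close>, and at most B points lie in S. Multiplying by k avoids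
  division.\<close>

lemma card_fibre_le:
  assumes f: "rf_degree f \<ge> 1" and "finite S" and "card S \<le> B"
    and k: "\<And>w. rf_eval f (Fin w) = \<alpha> \<Longrightarrow> Fin w \<notin> S \<Longrightarrow> ram_index f (Fin w) \<ge> k"
  shows "k * card {w. poly (fibre_poly f \<alpha>) w = 0} \<le> k * B + rf_degree f"
proof -
  let ?R = "{w. poly (fibre_poly f \<alpha>) w = 0}"
  let ?S = "{w \<in> ?R. Fin w \<in> S}" and ?N = "{w \<in> ?R. Fin w \<notin> S}"
  have fin: "finite ?R"
    using fibre_poly_nonzero[OF f] by (simp add: poly_roots_finite)
  have "inj_on Fin ?S" "Fin ` ?S \<subseteq> S"
    by (auto intro: inj_onI)
  then have S: "card ?S \<le> B"
    using assms(2,3) card_inj_on_le le_trans by blast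
  have "k * card ?N = (\<Sum>w\<in>?N. k)" by simp
  also have "\<dots> \<le> (\<Sum>w\<in>?N. order w (fibre_poly f \<alpha>))"
  proof (rule sum_mono)
    fix w assume "w \<in> ?N"
    then show "k \<le> order w (fibre_poly f \<alpha>)"
      using k[of w] ram_index_Fin[OF f, of \<alpha> w] by (simp add: rf_eval_Fin_iff)
  qed
  also have "\<dots> \<le> (\<Sum>w\<in>?R. order w (fibre_poly f \<alpha>))"
    using fin by (intro sum_mono2) auto
  also have "\<dots> \<le> rf_degree f"
    by (rule sum_order_fibre_le[OF f])
  finally have N: "k * card ?N \<le> rf_degree f" .
  have "card ?R \<le> card ?S + card ?N"
    by (rule order_trans[OF card_mono card_Un_le]) (use fin in auto)
  then have "k * card ?R \<le> k * card ?S + k * card ?N"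
    unfolding add_mult_distrib2[symmetric] by (rule mult_le_mono2)
  also have "\<dots> \<le> k * B + rf_degree f"
    using N by (rule add_mono[OF mult_le_mono2[OF S]])
  finally show ?thesis .
qed

section \<open>Comparison of three fibres of a high iterate\<close>

lemma ram_index_pos: "rf_degree f \<ge> 1 \<Longrightarrow> ram_index f z > 0"
  using ram_index_eq_fibre_mult[of f z "rf_eval f z"] rf_eval_iff_fibre_mult[of f z "rf_eval f z"] by simp

lemma rf_degree_iter_pos: "rf_degree f \<ge> 2 \<Longrightarrow> rf_degree (rf_iter f n) \<ge> 1"
  using degree_rf_iter[of f n] one_le_power[of "2::nat" n] by linarith

theorem theorem4p3:
  fixes m :: nat and \<phi> :: ratfun and \<alpha>\<^sub>1 \<alpha>\<^sub>2 :: proj_line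
  assumes "m \<ge> 6"
    and "rf_degree \<phi> \<ge> 2"
    and "\<alpha>\<^sub>1 \<noteq> \<alpha>\<^sub>2"
    and "branch_abundant m \<phi> \<alpha>\<^sub>1"
    and "branch_abundant m \<phi> \<alpha>\<^sub>2"
  shows "trivial_wrt m \<phi> {\<alpha>\<^sub>1, \<alpha>\<^sub>2}"
  unfolding trivial_wrt_def
proof (intro allI impI, rule ccontr)
  fix z assume z: "rf_eval \<phi> z \<in> {\<alpha>\<^sub>1, \<alpha>\<^sub>2} \<and> z \<notin> {\<alpha>\<^sub>1, \<alpha>\<^sub>2}" and ndvd: "\<not> m dvd ram_index \<phi> z"
  define g where "g = rf_iter \<phi>"
  define D where "D n = rf_degree (g n)" for n
  define R where "R n \<alpha> = {w. poly (fibre_poly (g n) \<alpha>) w = 0}" for n \<alpha>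
  define S where "S \<alpha> n = {z. rf_eval (g n) z = \<alpha> \<and> \<not> m dvd ram_index (g n) z}" for \<alpha> n
  have deg: "rf_degree \<phi> \<ge> 1" "rf_degree (g n) \<ge> 1" for n
    using assms(2) rf_degree_iter_pos by (auto simp: g_def)
  have "\<exists>B. \<forall>n. finite (S \<alpha> n) \<and> card (S \<alpha> n) \<le> B" if "\<alpha> \<in> {\<alpha>\<^sub>1, \<alpha>\<^sub>2}" for \<alpha>
    using assms(4,5) that unfolding branch_abundant_def S_def g_def Let_def by blast
  then obtain B where B: "\<And>\<alpha> n. \<alpha> \<in> {\<alpha>\<^sub>1, \<alpha>\<^sub>2} \<Longrightarrow> finite (S \<alpha> n) \<and> card (S \<alpha> n) \<le> B \<alpha>"
    by metis
  have abundant: "6 * card (R n \<alpha>) \<le> 6 * B \<alpha> + D n" if "\<alpha> \<in> {\<alpha>\<^sub>1, \<alpha>\<^sub>2}" for n \<alpha>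
    unfolding R_def D_def
  proof (rule card_fibre_le[OF deg(2)])
    show "6 \<le> ram_index (g n) (Fin w)" if "rf_eval (g n) (Fin w) = \<alpha>" "Fin w \<notin> S \<alpha> n" for w
      using that assms(1) ram_index_pos[OF deg(2), of n "Fin w"] by (auto simp: S_def dest!: dvd_imp_le)
  qed (use B[OF that] in auto)
  define \<alpha> where "\<alpha> = rf_eval \<phi> z"
  have \<alpha>: "\<alpha> \<in> {\<alpha>\<^sub>1, \<alpha>\<^sub>2}"
    using z by (simp add: \<alpha>_def)
  have exceptional: "2 * card (R n z) \<le> 2 * B \<alpha> + D n" for n
    unfolding R_def D_def
  proof (rule card_fibre_le[OF deg(2)])
    \<comment> \<open>The points over z are points of the fibre of the next iterate over \<alpha>,
      so its exceptional set is used here; the bound \<open>B \<alpha>\<close> is uniform in the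
      iterate.\<close>
    fix w assume w: "rf_eval (g n) (Fin w) = z" "Fin w \<notin> S \<alpha> (Suc n)"
    have g_Suc: "g (Suc n) = rf_comp \<phi> (g n)"
      by (simp add: g_def rf_iter_def)
    have "rf_eval (g (Suc n)) (Fin w) = \<alpha>"
      using rf_eval_rf_comp_Fin[OF deg(1) deg(2)] w(1) by (simp add: g_Suc \<alpha>_def)
    then have "m dvd ram_index \<phi> z * ram_index (g n) (Fin w)"
      using w ram_index_rf_comp_Fin[OF deg(1) deg(2), of n w] by (simp add: S_def g_Suc)
    then have "ram_index (g n) (Fin w) \<noteq> 1"
      using ndvd by auto
    then show "2 \<le> ram_index (g n) (Fin w)"
      using ram_index_pos[OF deg(2), of n "Fin w"] by linarith
  qed (use B[OF \<alpha>] in auto)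
  \<comment> \<open>Six times the sum of the three cardinalities is at most 5 * \<open>D n\<close>
    plus this constant, whereas the Wronskian bound makes it exceed 6 * \<open>D n\<close>. Hence
    \<open>D n\<close> < n, against \<open>D n\<close> \<ge> 2^n > n.\<close>
  define n where "n = 6 * (B \<alpha>\<^sub>1 + B \<alpha>\<^sub>2 + B \<alpha>)"
  have "3 * D n < 2 * D n + (card (R n \<alpha>\<^sub>1) + card (R n \<alpha>\<^sub>2) + card (R n z))"
    using fibres_card_ge[OF deg(2), of "{\<alpha>\<^sub>1, \<alpha>\<^sub>2, z}" n] z assms(3)
    by (auto simp: R_def D_def add.assoc)
  moreover have "6 * card (R n \<alpha>\<^sub>1) \<le> 6 * B \<alpha>\<^sub>1 + D n" "6 * card (R n \<alpha>\<^sub>2) \<le> 6 * B \<alpha>\<^sub>2 + D n"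
    "2 * card (R n z) \<le> 2 * B \<alpha> + D n"
    using abundant exceptional by auto
  ultimately have "D n < n"
    using n_def by simp
  moreover have "n < D n"
    using degree_rf_iter[OF assms(2), of n] less_exp[of n] unfolding D_def g_def by linarith
  ultimately show False by simp
qed

end
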